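(* Let $P_X^0\in\mathcal P_X$ and $P_Y^0=\gamma(P_X^0)\in\mathcal P_Y$ be the true input and output distributions, and let $\psi:\mathcal P_X\to\mathbb R$. Let $\mathcal U\subset\mathcal P_Y$ be a set constructed from the data $D$, and suppose $\mathcal U$ is a $(1-\alpha)$-level confidence region for $P_Y^0$, i.e. $\mathbb P_D(P_Y^0\in\mathcal U)\ge 1-\alpha$. Let $\overline Z$ and $\underline Z$ be respectively the optimal values of $$\max\ \psi(P_X)\ \text{ subject to }\ \gamma(P_X)\in\mathcal U,\ P_X\in\mathcal P_X,\qquad\text{and}\qquad \min\ \psi(P_X)\ \text{ subject to }\ \gamma(P_X)\in\mathcal U,\ P_X\in\mathcal P_X .$$ Then $$\mathbb P_D(\underline Z\le\psi(P_X^0)\le\overline Z)\ge 1-\alpha .$$ Similarly, if the confidence is approximate, i.e. (with $\mathcal U$, $\overline Z$, $\underline Z$ depending on the data size $n$) $\liminf_{n\to\infty}\mathbb P_D(P_Y^0\in\mathcal U)\ge 1-\alpha$, then $$\liminf_{n\to\infty}\mathbb P_D(\underline Z\le\psi(P_X^0)\le\overline Z)\ge 1-\alpha .$$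
   Context: An input variate $X$ takes values in a space $\mathcal X$ and has distribution $P_X$. For a fixed horizon $T$, $\mathbf X=(X_1,\dots,X_T)$ is i.i.d. with marginal $P_X$, and $h:\mathcal X^T\to\mathbb R$ is a fixed (measurable) system function. The output is $Y=h(\mathbf X)$, with distribution $P_Y=\gamma(P_X)$; thus $\gamma$ maps an input distribution to the law of $h(\mathbf X)$ under the $T$-fold product measure. $\mathcal P_X$ and $\mathcal P_Y$ are the spaces of all possible input and output distributions, with $\gamma(\mathcal P_X)\subset\mathcal P_Y$. The data $D=\{y_1,\dots,y_n\}$ are $n$ observations of $h(\mathbf X)$ under the true input distribution $P_X^0$, and $\mathbb P_D$ is the probability with respect to $D$. Optimal values are understood as the supremum/infimum over the feasible set. $\alpha\in(0,1)$. The events whose probabilities appear are tacitly assumed measurable. *)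

theory Defs
  imports "HOL-Probability.Probability"
begin

definition output_law :: "nat \<Rightarrow> ((nat \<Rightarrow> 'a) \<Rightarrow> real) \<Rightarrow> 'a measure \<Rightarrow> real measure" where
  "output_law T h P = distr (Pi\<^sub>M {1..T} (\<lambda>_. P)) borel h"

(* L is the joint law of a data vector (y_1,...,y_n) whose entries all have law Q.
   Nothing is required of the dependence between the entries; the i.i.d. case is
   L = Pi\<^sub>M {1..n} (\<lambda>_. Q). *)
definition data_law :: "nat \<Rightarrow> real measure \<Rightarrow> (nat \<Rightarrow> real) measure \<Rightarrow> bool" where
  "data_law n Q L \<longleftrightarrow>
     L \<in> space (prob_algebra (Pi\<^sub>M {1..n} (\<lambda>_. borel))) \<and>
     (\<forall>i\<in>{1..n}. distr L borel (\<lambda>D. D i) = Q)"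

definition feasible :: "('a measure \<Rightarrow> real measure) \<Rightarrow> 'a measure set \<Rightarrow> real measure set \<Rightarrow> 'a measure set" where
  "feasible \<gamma> \<P>X V = {P \<in> \<P>X. \<gamma> P \<in> V}"

(* The optimal values are extended reals: they may be infinite, and an infeasible
   program has upper value -\<infinity> and lower value \<infinity>. *)
definition Z_upper :: "('a measure \<Rightarrow> real measure) \<Rightarrow> ('a measure \<Rightarrow> real) \<Rightarrow> 'a measure set \<Rightarrow> real measure set \<Rightarrow> ereal" where
  "Z_upper \<gamma> \<psi> \<P>X V = (SUP P \<in> feasible \<gamma> \<P>X V. ereal (\<psi> P))"

definition Z_lower :: "('a measure \<Rightarrow> real measure) \<Rightarrow> ('a measure \<Rightarrow> real) \<Rightarrow> 'a measure set \<Rightarrow> real measure set \<Rightarrow> ereal" where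
  "Z_lower \<gamma> \<psi> \<P>X V = (INF P \<in> feasible \<gamma> \<P>X V. ereal (\<psi> P))"

definition cover_event ::
  "(nat \<Rightarrow> real) measure \<Rightarrow> ((nat \<Rightarrow> real) \<Rightarrow> real measure set) \<Rightarrow> real measure \<Rightarrow> (nat \<Rightarrow> real) set" where
  "cover_event L U Q = {D \<in> space L. Q \<in> U D}"

definition bounds_event ::
  "(nat \<Rightarrow> real) measure \<Rightarrow> ((nat \<Rightarrow> real) \<Rightarrow> real measure set) \<Rightarrow> ('a measure \<Rightarrow> real measure) \<Rightarrow>
   ('a measure \<Rightarrow> real) \<Rightarrow> 'a measure set \<Rightarrow> 'a measure \<Rightarrow> (nat \<Rightarrow> real) set" where
  "bounds_event L U \<gamma> \<psi> \<P>X P =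
     {D \<in> space L. Z_lower \<gamma> \<psi> \<P>X (U D) \<le> ereal (\<psi> P) \<and> ereal (\<psi> P) \<le> Z_upper \<gamma> \<psi> \<P>X (U D)}"

end

theory Submission
  imports Defs
begin

text \<open>Whenever the data put the true output law into the confidence set, the true input law is
  itself a feasible point of both programs, so its \<open>\<psi>\<close>-value lies between their
  infimum and supremum, attained or not. This is a pointwise inclusion of events,
  \<open>cover_event_subset_bounds_event\<close>; probability enters only through monotonicity,
  first of the measure at each data size, then of liminf.\<close>

lemma cover_event_subset_bounds_event:
  assumes "P \<in> \<P>X"
  shows "cover_event L U (\<gamma> P) \<subseteq> bounds_event L U \<gamma> \<psi> \<P>X P"
  unfolding cover_event_def bounds_event_def Z_lower_def Z_upper_def feasible_def
  using assms by (auto intro: INF_lower SUP_upper)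

theorem proposition1:
  fixes MX :: "'a measure" and T :: nat and h :: "(nat \<Rightarrow> 'a) \<Rightarrow> real"
    and \<gamma> :: "'a measure \<Rightarrow> real measure"
    and \<P>X :: "'a measure set" and \<P>Y :: "real measure set"
    and PX0 :: "'a measure" and PY0 :: "real measure"
    and \<psi> :: "'a measure \<Rightarrow> real"
    and PD :: "nat \<Rightarrow> (nat \<Rightarrow> real) measure"
    and U :: "nat \<Rightarrow> (nat \<Rightarrow> real) \<Rightarrow> real measure set"
    and \<alpha> :: real
  assumes "T \<ge> 1"
    and "h \<in> borel_measurable (Pi\<^sub>M {1..T} (\<lambda>_. MX))"
    and "\<gamma> = output_law T h"
    and "\<P>X \<subseteq> space (prob_algebra MX)"
    and "\<P>Y \<subseteq> space (prob_algebra borel)"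
    and "\<gamma> ` \<P>X \<subseteq> \<P>Y"
    and "PX0 \<in> \<P>X"
    and "PY0 = \<gamma> PX0"
    and "0 < \<alpha>" and "\<alpha> < 1"
    and "\<And>n. n \<ge> 1 \<Longrightarrow> data_law n PY0 (PD n)"
    and "\<And>n D. n \<ge> 1 \<Longrightarrow> D \<in> space (PD n) \<Longrightarrow> U n D \<subseteq> \<P>Y"
    and "\<And>n. n \<ge> 1 \<Longrightarrow> cover_event (PD n) (U n) PY0 \<in> sets (PD n)"
    and "\<And>n. n \<ge> 1 \<Longrightarrow> bounds_event (PD n) (U n) \<gamma> \<psi> \<P>X PX0 \<in> sets (PD n)"
  shows "(\<forall>n\<ge>1. measure (PD n) (cover_event (PD n) (U n) PY0) \<ge> 1 - \<alpha> \<longrightarrow>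
           measure (PD n) (bounds_event (PD n) (U n) \<gamma> \<psi> \<P>X PX0) \<ge> 1 - \<alpha>) \<and>
         (liminf (\<lambda>n. ereal (measure (PD n) (cover_event (PD n) (U n) PY0))) \<ge> ereal (1 - \<alpha>) \<longrightarrow>
           liminf (\<lambda>n. ereal (measure (PD n) (bounds_event (PD n) (U n) \<gamma> \<psi> \<P>X PX0))) \<ge> ereal (1 - \<alpha>))"
proof -
  have mono: "measure (PD n) (cover_event (PD n) (U n) PY0)
      \<le> measure (PD n) (bounds_event (PD n) (U n) \<gamma> \<psi> \<P>X PX0)" if "n \<ge> 1" for n
  proof -
    \<comment> \<open>Monotonicity of the real-valued \<open>measure\<close> rests on finiteness,
      which \<open>data_law\<close> supplies through membership in
      \<open>prob_algebra\<close>.\<close>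
    have "prob_space (PD n)"
      using assms(11)[OF that] by (simp add: data_law_def space_prob_algebra)
    then interpret prob_space "PD n" .
    show ?thesis
      \<comment> \<open>Writing \<open>PY0\<close> as \<open>\<gamma> PX0\<close> turns coverage of
        the output law into feasibility of \<open>PX0\<close>.\<close>
      unfolding assms(8)
      by (intro finite_measure_mono cover_event_subset_bounds_event assms(7) assms(14) that)
  qed
  \<comment> \<open>The comparison is available only from n = 1 on, as \<open>PD 0\<close> is
    unconstrained; liminf ignores this initial term.\<close>
  have "liminf (\<lambda>n. ereal (measure (PD n) (cover_event (PD n) (U n) PY0)))
      \<le> liminf (\<lambda>n. ereal (measure (PD n) (bounds_event (PD n) (U n) \<gamma> \<psi> \<P>X PX0)))"
    by (intro Liminf_mono eventually_sequentiallyI[of 1]) (simp add: mono)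
  \<comment> \<open>In both claims the coverage bound 1 - \<alpha> passes to the larger quantity by
    transitivity.\<close>
  with mono show ?thesis
    by (meson order_trans)
qed

end
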